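(* Let $\alpha,\beta,\gamma$ be positive integers with $\alpha\ge 2\gamma$, $\beta\ge\gamma\ge 1$ and $\alpha+\beta>3$, and let $G_2=\langle a \rangle\rtimes\langle b \rangle$, where $[a,b]=a^{2^{\alpha-\gamma}}$, $o(a)=2^{\alpha}$, $o(b)=2^{\beta}$, $o([a,b])=2^{\gamma}$. If $G$ is a finite group such that $G\cong G_2$, then $\mathsf{D}_o(G)=\mathsf{d}(G)+1$.
   Context: Commutators are $[x,y]=x^{-1}y^{-1}xy$, and $o(x)$ is the order of $x$. In $\langle a\rangle\rtimes\langle b\rangle$ the subgroup $\langle a\rangle$ is normal and $\langle a\rangle\cap\langle b\rangle=1$. A sequence over a finite group $G$ is a finite unordered multiset of elements of $G$ (an element of the free abelian monoid $\mathcal{F}(G)$ on $G$), of length $|S|$ counted with multiplicity. For $S=g_1\cdot g_2\cdots g_\ell$, $\pi(S)=\{\prod_{i=1}^{\ell} g_{\sigma(i)} : \sigma\in\mathfrak{S}_\ell\}$, and $\Pi(S)=\bigcup_{T\mid S,\ |T|\ge1}\pi(T)$, the union over nonempty subsequences (sub-multisets) $T$ of $S$. The small Davenport constant is $\mathsf{d}(G)=\sup\{|S| : S\in\mathcal{F}(G),\ 1\notin\Pi(S)\}$. An ordered sequence over $G$ is a finite tuple $S^*=(g_1,\dots,g_\ell)$ of elements of $G$; $\Pi(S^* )$ is the set of products $g_{i_1}g_{i_2}\cdots g_{i_k}$ with $k\ge 1$ and $1\le i_1<\dots<i_k\le\ell$. The ordered Davenport constant $\mathsf{D}_o(G)$ is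 the least $k\in\mathbb{N}$ such that every ordered sequence $S^*$ over $G$ of length $|S^*|\ge k$ satisfies $1\in\Pi(S^* )$. *)

theory Defs
  imports "HOL-Algebra.Algebra" "HOL-Library.Multiset"
begin

definition commutator :: "('a, 'm) monoid_scheme \<Rightarrow> 'a \<Rightarrow> 'a \<Rightarrow> 'a" where
  "commutator G x y = inv\<^bsub>G\<^esub> x \<otimes>\<^bsub>G\<^esub> inv\<^bsub>G\<^esub> y \<otimes>\<^bsub>G\<^esub> x \<otimes>\<^bsub>G\<^esub> y"

definition list_product :: "('a, 'm) monoid_scheme \<Rightarrow> 'a list \<Rightarrow> 'a" where
  "list_product G xs = foldr (\<otimes>\<^bsub>G\<^esub>) xs \<one>\<^bsub>G\<^esub>"


text \<open>The lists \<open>xs\<close> with \<open>mset xs = S\<close> are exactly the orderings of the multiset \<open>S\<close>.\<close>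

definition seq_products :: "('a, 'm) monoid_scheme \<Rightarrow> 'a multiset \<Rightarrow> 'a set" where
  "seq_products G S = {list_product G xs | xs. mset xs = S}"

definition subseq_products :: "('a, 'm) monoid_scheme \<Rightarrow> 'a multiset \<Rightarrow> 'a set" where
  "subseq_products G S = (\<Union>T \<in> {T. T \<subseteq># S \<and> size T \<ge> 1}. seq_products G T)"

text \<open>The supremum is taken in \<^typ>\<open>nat\<close>; for a finite group the set is nonempty and bounded
  (lemmas \<open>zero_in_small_davenport_set\<close> and \<open>bdd_above_small_davenport_set\<close> below).\<close>

definition small_davenport :: "('a, 'm) monoid_scheme \<Rightarrow> nat" where
  "small_davenport G =
     Sup {size S | S. set_mset S \<subseteq> carrier G \<and> \<one>\<^bsub>G\<^esub> \<notin> subseq_products G S}"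

text \<open>\<open>nths xs I\<close> lists the entries of \<open>xs\<close> with index in \<open>I\<close> in increasing order of index.\<close>

definition ordered_products :: "('a, 'm) monoid_scheme \<Rightarrow> 'a list \<Rightarrow> 'a set" where
  "ordered_products G xs = {list_product G (nths xs I) | I. I \<subseteq> {..<length xs} \<and> I \<noteq> {}}"

text \<open>For a finite group such a \<open>k\<close> exists (lemma \<open>ex_ordered_davenport_bound\<close> below).\<close>

definition ordered_davenport :: "('a, 'm) monoid_scheme \<Rightarrow> nat" where
  "ordered_davenport G =
     (LEAST k. \<forall>xs. set xs \<subseteq> carrier G \<and> length xs \<ge> k \<longrightarrow> \<one>\<^bsub>G\<^esub> \<in> ordered_products G xs)"

definition internal_semidirect ::
  "('a, 'm) monoid_scheme \<Rightarrow> 'a set \<Rightarrow> 'a set \<Rightarrow> bool" where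
  "internal_semidirect G N K \<longleftrightarrow>
     N \<lhd> G \<and> subgroup K G \<and> N \<inter> K = {\<one>\<^bsub>G\<^esub>} \<and> N <#>\<^bsub>G\<^esub> K = carrier G"

text \<open>\<open>is_G2 H a b \<alpha> \<beta> \<gamma>\<close>: the group \<open>H\<close> is \<open>\<langle>a\<rangle> \<rtimes> \<langle>b\<rangle>\<close> with the prescribed commutator relation and
  element orders. These data determine \<open>H\<close> up to isomorphism.\<close>

definition is_G2 ::
  "('a, 'm) monoid_scheme \<Rightarrow> 'a \<Rightarrow> 'a \<Rightarrow> nat \<Rightarrow> nat \<Rightarrow> nat \<Rightarrow> bool" where
  "is_G2 H a b \<alpha> \<beta> \<gamma> \<longleftrightarrow>
     group H \<and> a \<in> carrier H \<and> b \<in> carrier H \<and>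
     internal_semidirect H (generate H {a}) (generate H {b}) \<and>
     commutator H a b = a [^]\<^bsub>H\<^esub> ((2::nat) ^ (\<alpha> - \<gamma>)) \<and>
     group.ord H a = 2 ^ \<alpha> \<and> group.ord H b = 2 ^ \<beta> \<and>
     group.ord H (commutator H a b) = 2 ^ \<gamma>"


lemma (in monoid) list_product_closed:
  "set xs \<subseteq> carrier G \<Longrightarrow> list_product G xs \<in> carrier G"
  by (induction xs) (auto simp: list_product_def)

lemma (in monoid) list_product_append:
  assumes "set xs \<subseteq> carrier G" "set ys \<subseteq> carrier G"
  shows "list_product G (xs @ ys) = list_product G xs \<otimes> list_product G ys"
  using assms
proof (induction xs)
  case Nil
  then show ?case using list_product_closed[of ys] by (simp add: list_product_def)
next
  case (Cons x xs)
  then have "list_product G (xs @ ys) = list_product G xs \<otimes> list_product G ys" by simp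
  then show ?case
    using Cons.prems list_product_closed[of xs] list_product_closed[of ys]
    by (simp add: list_product_def m_assoc)
qed

lemma mset_nths_subseteq: "mset (nths xs I) \<subseteq># mset xs"
proof (induction xs arbitrary: I)
  case (Cons x xs)
  have "mset (nths xs J) \<subseteq># add_mset x (mset xs)" for J
    using Cons.IH[of J] mset_subset_eq_add_right[of "mset xs" "{#x#}"]
    by (auto intro: subset_mset.order_trans)
  with Cons.IH show ?case by (auto simp: nths_Cons)
qed simp

lemma ordered_products_subset:
  "ordered_products G xs \<subseteq> subseq_products G (mset xs)"
proof
  fix p assume "p \<in> ordered_products G xs"
  then obtain I where I: "I \<subseteq> {..<length xs}" "I \<noteq> {}" "p = list_product G (nths xs I)"
    by (auto simp: ordered_products_def)
  from I(2) obtain i where "i \<in> I" by blast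
  with I(1) have "xs ! i \<in> set (nths xs I)" by (auto simp: set_nths)
  then have "length (nths xs I) \<ge> 1" by (cases "nths xs I") auto
  moreover have "mset (nths xs I) \<subseteq># mset xs"
    by (rule mset_nths_subseteq)
  ultimately show "p \<in> subseq_products G (mset xs)"
    using I(3) by (auto simp: subseq_products_def seq_products_def intro!: exI[of _ "mset (nths xs I)"])
qed

lemma (in group) one_in_ordered_products:
  assumes fin: "finite (carrier G)" and xs: "set xs \<subseteq> carrier G"
    and len: "length xs \<ge> card (carrier G)"
  shows "\<one> \<in> ordered_products G xs"
proof -
  let ?f = "\<lambda>i. list_product G (take i xs)"
  have cl: "?f i \<in> carrier G" for i
    using xs by (intro list_product_closed) (auto dest: in_set_takeD)
  have "card (?f ` {..length xs}) \<le> card (carrier G)"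
    using fin cl by (intro card_mono) auto
  with len have "\<not> inj_on ?f {..length xs}"
    by (intro pigeonhole) simp
  then obtain i j where ij: "i < j" "j \<le> length xs" "?f i = ?f j"
    unfolding inj_on_def by (metis atMost_iff linorder_neqE_nat)
  let ?m = "take (j - i) (drop i xs)"
  have split: "take j xs = take i xs @ ?m"
    using take_add[of i "j - i" xs] ij by simp
  have m: "set ?m \<subseteq> carrier G"
    using xs by (auto dest!: in_set_takeD in_set_dropD)
  have t: "set (take i xs) \<subseteq> carrier G"
    using xs by (auto dest!: in_set_takeD)
  have "?f i \<otimes> list_product G ?m = ?f i"
    using ij(3) list_product_append[OF t m] by (simp only: split)
  then have one: "list_product G ?m = \<one>"
    using l_cancel_one[OF cl list_product_closed[OF m]] by simp
  have "nths xs {i..<j} = ?m"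
  proof -
    have "nths xs {i..<j} = nths (take i xs @ drop i xs) {i..<j}" by simp
    also have "\<dots> = nths (take i xs) {i..<j} @ nths (drop i xs) {k. k + i \<in> {i..<j}}"
      using ij by (subst nths_append) simp
    also have "nths (take i xs) {i..<j} = []"
      using set_nths[of "take i xs" "{i..<j}"] by (subst set_empty[symmetric]) auto
    also have "{k. k + i \<in> {i..<j}} = {..<j - i}" by auto
    finally show ?thesis by simp
  qed
  moreover have "{i..<j} \<subseteq> {..<length xs}" "{i..<j} \<noteq> {}" using ij by auto
  ultimately show ?thesis
    unfolding ordered_products_def mem_Collect_eq using one by (intro exI[of _ "{i..<j}"]) simp
qed

lemma (in group) ex_ordered_davenport_bound:
  assumes "finite (carrier G)"
  shows "\<exists>k. \<forall>xs. set xs \<subseteq> carrier G \<and> length xs \<ge> k \<longrightarrow> \<one> \<in> ordered_products G xs"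
  using one_in_ordered_products[OF assms] by blast

lemma zero_in_small_davenport_set:
  "0 \<in> {size S | S. set_mset S \<subseteq> carrier G \<and> \<one>\<^bsub>G\<^esub> \<notin> subseq_products G S}"
  by (auto simp: subseq_products_def intro!: exI[of _ "{#}"])

lemma (in group) bdd_above_small_davenport_set:
  assumes fin: "finite (carrier G)"
  shows "bdd_above {size S | S. set_mset S \<subseteq> carrier G \<and> \<one> \<notin> subseq_products G S}"
proof (rule bdd_aboveI[where M = "card (carrier G)"])
  fix n assume "n \<in> {size S | S. set_mset S \<subseteq> carrier G \<and> \<one> \<notin> subseq_products G S}"
  then obtain S where S: "n = size S" "set_mset S \<subseteq> carrier G" "\<one> \<notin> subseq_products G S"
    by blast
  obtain xs where xs: "mset xs = S" by (metis ex_mset)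
  show "n \<le> card (carrier G)"
  proof (rule ccontr)
    assume "\<not> n \<le> card (carrier G)"
    with S xs have "\<one> \<in> ordered_products G xs"
      by (intro one_in_ordered_products[OF fin]) auto
    with S xs ordered_products_subset[of G xs] show False by auto
  qed
qed

end

theory Submission
  imports Defs "HOL-Library.Z2" "HOL-Library.Function_Algebras"
begin

text \<open>
  Both Davenport constants are squeezed against \<open>L = 2 ^ \<alpha> + 2 ^ \<beta> - 1\<close>:
  \<open>ordered_davenport G \<le> L \<le> small_davenport G + 1 \<le> ordered_davenport G\<close>.
  The last inequality holds in every finite group: a product-one free sequence stays
  product-one free in whichever order it is listed. The middle one comes from the sequence of
  \<open>2 ^ \<alpha> - 1\<close> copies of \<open>a\<close> and \<open>2 ^ \<beta> - 1\<close> copies of \<open>b\<close>.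

  The first inequality is an argument in the group algebra of \<open>G\<close> over the field with two elements.
  If no nonempty ordered subproduct of \<open>g\<^sub>1, \<dots>, g\<^sub>l\<close> is the identity, then
  \<open>(g\<^sub>1 + 1) \<cdots> (g\<^sub>l + 1)\<close> has coefficient \<open>1\<close> at the identity, so it is nonzero
  (\<open>difference_product_at_one\<close>). It is thus enough that every product of \<open>L\<close> factors
  \<open>g + 1\<close> vanishes, that is, that the \<open>L\<close>-th power of the augmentation ideal is zero.
  Put \<open>x = a + 1\<close> and \<open>y = b + 1\<close>. In characteristic two,
  \<open>x ^ (2 ^ \<alpha>) = a ^ (2 ^ \<alpha>) + 1 = 0\<close> and likewise \<open>y ^ (2 ^ \<beta>) = 0\<close>, so the span of
  the \<open>x ^ i y ^ j\<close> with \<open>i + j \<ge> n\<close> is zero once \<open>n \<ge> L\<close>. It remains to see that each factor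
  \<open>g + 1\<close> carries the \<open>n\<close>-th span into the next one. This property is inherited by
  products in \<open>G\<close>, so only \<open>a\<close> and \<open>b\<close> matter. For \<open>a\<close> it is clear. For \<open>b\<close>, normality
  of \<open>\<langle>a\<rangle>\<close> gives \<open>b a = a ^ r b\<close>; the exponent \<open>r\<close> is odd because \<open>a ^ r\<close> is
  conjugate to \<open>a\<close> and so has the same order. With \<open>r = 2 * k + 1\<close>,
  \<open>y x = (a ^ r + 1) y + a (a ^ (2 * k) + 1)\<close>,
  where the last term contains \<open>a ^ 2 + 1 = x ^ 2\<close>. Hence moving \<open>y\<close> to the right past \<open>x\<close> never
  lowers the total degree (\<open>difference_raises_B\<close>).
\<close>

section \<open>Nilpotent operators in characteristic two\<close>

text \<open>
  \<open>A\<close> and \<open>B\<close> stand for the actions of \<open>a\<close> and \<open>b\<close> on a module over the group algebra.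
  Working with operators on an abstract group of exponent two avoids constructing that algebra.
\<close>

locale twisted_operator_pair =
  fixes A B :: "'v::ab_group_add \<Rightarrow> 'v" and k s t :: nat
  assumes char2: "v + v = (0::'v)"
    and A_add: "A (v + w) = A v + A w"
    and B_add: "B (v + w) = B v + B w"
    and A_period: "(A ^^ (2 ^ s)) v = v"
    and B_period: "(B ^^ (2 ^ t)) v = v"
    and twist: "B (A v) = (A ^^ (2 * k + 1)) (B v)"
begin

lemma cancel2: "v + (v + w) = (w::'v)"
  by (metis add.assoc add_0 char2)

definition dA :: "'v \<Rightarrow> 'v" where "dA v = A v + v"
definition dB :: "'v \<Rightarrow> 'v" where "dB v = B v + v"

lemma dA_add: "dA (v + w) = dA v + dA w"
  by (simp add: dA_def A_add ac_simps)

lemma dB_add: "dB (v + w) = dB v + dB w"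
  by (simp add: dB_def B_add ac_simps)

lemma dA_zero [simp]: "dA 0 = 0"
  using dA_add[of 0 0] by simp

lemma dB_zero [simp]: "dB 0 = 0"
  using dB_add[of 0 0] by simp

lemma dA_pow_zero: "(dA ^^ i) 0 = 0"
  by (induction i) auto

text \<open>
  The Frobenius identity \<open>(f + 1) ^ (2 ^ n) = f ^ (2 ^ n) + 1\<close>: squaring is additive
  because the cross terms cancel in pairs.
\<close>

lemma frobenius:
  fixes f :: "'v \<Rightarrow> 'v"
  assumes add: "\<And>v w. f (v + w) = f v + f w"
  shows "((\<lambda>v. f v + v) ^^ (2 ^ n)) v = (f ^^ (2 ^ n)) v + v"
proof (induction n arbitrary: v)
  case (Suc n)
  have pow_add: "(f ^^ m) (v + w) = (f ^^ m) v + (f ^^ m) w" for m v w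
    by (induction m) (auto simp: add)
  have double: "(g ^^ (2 ^ Suc n)) v = (g ^^ (2 ^ n)) ((g ^^ (2 ^ n)) v)" for g :: "'v \<Rightarrow> 'v" and v
    by (simp add: mult_2 funpow_add)
  show ?case
    unfolding double Suc pow_add by (simp add: ac_simps cancel2)
qed simp

lemma dA_nilpotent: "i \<ge> 2 ^ s \<Longrightarrow> (dA ^^ i) v = 0"
proof -
  have "dA = (\<lambda>v. A v + v)" by (auto simp: dA_def)
  then have z: "(dA ^^ (2 ^ s)) v = 0" for v
    using frobenius[of A s] by (simp add: A_add A_period char2)
  assume "i \<ge> 2 ^ s"
  then have "i = (i - 2 ^ s) + 2 ^ s" by simp
  then have "(dA ^^ i) v = (dA ^^ (i - 2 ^ s)) ((dA ^^ (2 ^ s)) v)"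
    by (metis comp_apply funpow_add)
  then show ?thesis by (simp add: z dA_pow_zero)
qed

lemma dB_nilpotent: "j \<ge> 2 ^ t \<Longrightarrow> (dB ^^ j) v = 0"
proof -
  have "dB = (\<lambda>v. B v + v)" by (auto simp: dB_def)
  then have z: "(dB ^^ (2 ^ t)) v = 0" for v
    using frobenius[of B t] by (simp add: B_add B_period char2)
  have dB_pow_zero: "(dB ^^ i) 0 = 0" for i
    by (induction i) auto
  assume "j \<ge> 2 ^ t"
  then have "j = (j - 2 ^ t) + 2 ^ t" by simp
  then have "(dB ^^ j) v = (dB ^^ (j - 2 ^ t)) ((dB ^^ (2 ^ t)) v)"
    by (metis comp_apply funpow_add)
  then show ?thesis by (simp add: z dB_pow_zero)
qed

text \<open>
  The image of the span of the words \<open>dA ^ i dB ^ j\<close> of degree at least \<open>n\<close>.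
  As scalars are \<open>0\<close> and \<open>1\<close>, closure under addition is all that a span requires.
\<close>

inductive_set filt :: "nat \<Rightarrow> 'v set" for n :: nat where
  zero: "0 \<in> filt n"
| add: "v \<in> filt n \<Longrightarrow> w \<in> filt n \<Longrightarrow> v + w \<in> filt n"
| monomial: "i + j \<ge> n \<Longrightarrow> (dA ^^ i) ((dB ^^ j) v) \<in> filt n"

lemma filt_antimono: "v \<in> filt n \<Longrightarrow> m \<le> n \<Longrightarrow> v \<in> filt m"
  by (induction rule: filt.induct) (auto intro: filt.intros)

text \<open>
  A word of degree at least \<open>2 ^ s + 2 ^ t - 1\<close> contains \<open>2 ^ s\<close> factors \<open>dA\<close> or
  \<open>2 ^ t\<close> factors \<open>dB\<close>.
\<close>

lemma filt_trivial: "v \<in> filt n \<Longrightarrow> n \<ge> 2 ^ s + 2 ^ t - 1 \<Longrightarrow> v = 0"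
proof (induction rule: filt.induct)
  case (monomial i j v)
  then have "i \<ge> 2 ^ s \<or> j \<ge> 2 ^ t" by linarith
  then show ?case by (auto simp: dA_nilpotent dB_nilpotent dA_pow_zero)
qed auto

definition difference_raises :: "nat \<Rightarrow> ('v \<Rightarrow> 'v) \<Rightarrow> bool" where
  "difference_raises d f \<longleftrightarrow> (\<forall>n. \<forall>v \<in> filt n. f v + v \<in> filt (n + d))"

lemma difference_raisesD: "difference_raises d f \<Longrightarrow> v \<in> filt n \<Longrightarrow> f v + v \<in> filt (n + d)"
  by (simp add: difference_raises_def)

lemma difference_raises_preserves: "difference_raises d f \<Longrightarrow> v \<in> filt n \<Longrightarrow> f v \<in> filt n"
proof -
  assume "difference_raises d f" "v \<in> filt n"
  then have "f v + v \<in> filt n"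
    by (rule filt_antimono[OF difference_raisesD]) simp
  then have "(f v + v) + v \<in> filt n"
    using \<open>v \<in> filt n\<close> by (rule filt.add)
  then show ?thesis by (simp add: add.assoc char2)
qed

text \<open>The reason is the identity \<open>f g + 1 = (f + 1) g + (g + 1)\<close>.\<close>

lemma difference_raises_comp:
  assumes "difference_raises d f" "difference_raises d g"
  shows "difference_raises d (f \<circ> g)"
proof -
  have "(f \<circ> g) v + v \<in> filt (n + d)" if v: "v \<in> filt n" for n v
  proof -
    have "f (g v) + g v \<in> filt (n + d)"
      by (intro difference_raisesD[OF assms(1)] difference_raises_preserves[OF assms(2) v])
    then have "(f (g v) + g v) + (g v + v) \<in> filt (n + d)"
      using difference_raisesD[OF assms(2) v] by (rule filt.add)
    then show ?thesis
      by (simp add: add.assoc cancel2)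
  qed
  then show ?thesis by (simp add: difference_raises_def)
qed

lemma difference_raises_funpow: "difference_raises d f \<Longrightarrow> difference_raises d (f ^^ m)"
proof (induction m)
  case 0
  then show ?case by (simp add: difference_raises_def char2 filt.zero)
qed (simp add: difference_raises_comp)

lemma difference_raises_A: "difference_raises 1 A"
proof -
  have "dA v \<in> filt (n + 1)" if "v \<in> filt n" for n v
    using that
  proof (induction rule: filt.induct)
    case (monomial i j v)
    then show ?case using filt.monomial[of "n + 1" "Suc i" j v] by simp
  qed (auto simp: dA_add intro: filt.intros)
  then show ?thesis by (simp add: difference_raises_def dA_def)
qed

text \<open>
  The square of \<open>A\<close> gains two degrees, since \<open>A\<^sup>2 + 1 = (A + 1)\<^sup>2\<close>. This pays for the
  \<open>dB\<close> that is lost in the second summand of \<open>dB_dA_straighten\<close>.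
\<close>

lemma difference_raises_A_square: "difference_raises 2 (A \<circ> A)"
proof -
  have "A (A v) + v = dA (dA v)" for v
    by (simp add: dA_def A_add add.assoc cancel2)
  moreover have "dA (dA v) \<in> filt (n + 2)" if "v \<in> filt n" for n v
    using difference_raisesD[OF difference_raises_A difference_raisesD[OF difference_raises_A that]]
    by (simp add: dA_def)
  ultimately show ?thesis by (simp add: difference_raises_def)
qed

text \<open>
  The commutation rule that moves \<open>dB\<close> past \<open>dA\<close>. Both summands are grouped so that each one
  visibly has degree at least two: \<open>A ^ (2 * k + 1) + 1\<close> applied after \<open>dB\<close>, and
  \<open>A ^ (2 * k) + 1\<close>, which is a difference of powers of \<open>A\<^sup>2\<close>.
\<close>

lemma dB_dA_straighten:
  "dB (dA v) = ((A ^^ (2 * k + 1)) (dB v) + dB v) + A ((A ^^ (2 * k)) v + v)"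
proof -
  have pow_add: "(A ^^ m) (v + w) = (A ^^ m) v + (A ^^ m) w" for m v w
    by (induction m) (auto simp: A_add)
  have cancel2': "x + (y + (x + z)) = y + (z::'v)" for x y z
    by (metis add.left_commute cancel2)
  show ?thesis
    by (simp add: dA_def dB_def A_add B_add pow_add twist ac_simps cancel2 cancel2')
qed

text \<open>
  On a word \<open>dA ^ i dB ^ j\<close> the operator \<open>dB\<close> is pushed to the right through the factors
  \<open>dA\<close> one at a time, by induction on \<open>i\<close>.
\<close>

lemma difference_raises_B: "difference_raises 1 B"
proof -
  have mono: "dB ((dA ^^ i) ((dB ^^ j) v)) \<in> filt (i + j + 1)" for i j v
  proof (induction i)
    case 0
    then show ?case using filt.monomial[of "j + 1" 0 "Suc j" v] by simp
  next
    case (Suc i)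
    define w where "w = (dA ^^ i) ((dB ^^ j) v)"
    have w: "w \<in> filt (i + j)" "dB w \<in> filt (i + j + 1)"
      using Suc by (auto simp: w_def intro: filt.monomial)
    have "difference_raises 2 (A ^^ (2 * k))"
      using difference_raises_funpow[OF difference_raises_A_square, of k]
        funpow_mult[where f = A and m = 2 and n = k]
      by (simp add: numeral_2_eq_2 mult.commute)
    then have "A ((A ^^ (2 * k)) w + w) \<in> filt (i + j + 2)"
      using difference_raises_preserves[OF difference_raises_A] difference_raisesD w(1) by blast
    moreover have "(A ^^ (2 * k + 1)) (dB w) + dB w \<in> filt (i + j + 2)"
      using difference_raisesD[OF difference_raises_funpow[OF difference_raises_A] w(2), of "2 * k + 1"]
      by simp
    ultimately have "dB (dA w) \<in> filt (i + j + 2)"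
      unfolding dB_dA_straighten by (rule filt.add[rotated])
    then show ?case by (simp add: w_def)
  qed
  have "dB v \<in> filt (n + 1)" if "v \<in> filt n" for n v
    using that
  proof (induction rule: filt.induct)
    case (monomial i j v)
    then show ?case using filt_antimono[OF mono[of i j v]] by simp
  qed (auto simp: dB_add intro: filt.intros)
  then show ?thesis by (simp add: difference_raises_def dB_def)
qed

text \<open>Each factor \<open>f + 1\<close> gains a degree, and the filtration ends at \<open>2 ^ s + 2 ^ t - 1\<close>.\<close>

lemma product_of_differences_vanishes:
  assumes "\<And>f. f \<in> set fs \<Longrightarrow> difference_raises 1 f" and "length fs \<ge> 2 ^ s + 2 ^ t - 1"
  shows "foldr (\<lambda>f v. f v + v) fs v = 0"
proof -
  have "foldr (\<lambda>f v. f v + v) fs v \<in> filt (length fs)"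
    using assms(1)
  proof (induction fs)
    case Nil
    then show ?case using filt.monomial[of 0 0 0 v] by simp
  next
    case (Cons f fs)
    then show ?case using difference_raisesD[of 1 f _ "length fs"] by simp
  qed
  then show ?thesis using assms(2) by (rule filt_trivial)
qed

end


section \<open>Left translations and products of subsequences\<close>

context group
begin

text \<open>
  Left multiplication by \<open>g\<close> in the group algebra, whose elements are functions to the field with
  two elements. Leaving the values outside the carrier alone makes
  \<open>translate\<close> a group action on all functions, so that its laws hold as equations of functions.
\<close>

definition translate :: "'a \<Rightarrow> ('a \<Rightarrow> bit) \<Rightarrow> ('a \<Rightarrow> bit)" where
  "translate g f = (\<lambda>h. if h \<in> carrier G then f (inv g \<otimes> h) else f h)"

lemma translate_mult:
  "g \<in> carrier G \<Longrightarrow> h \<in> carrier G \<Longrightarrow> translate (g \<otimes> h) f = translate g (translate h f)"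
  by (auto simp: translate_def inv_mult_group m_assoc)

lemma translate_one: "translate \<one> f = f"
  by (auto simp: translate_def)

lemma translate_pow: "g \<in> carrier G \<Longrightarrow> translate (g [^] n) = translate g ^^ n"
proof (induction n)
  case 0
  then show ?case by (auto simp: translate_one)
next
  case (Suc n)
  then show ?case
    by (auto simp: translate_mult funpow_Suc_right simp del: funpow.simps)
qed

lemma translate_add: "translate g (v + w) = translate g v + translate g w"
  by (auto simp: translate_def)

lemma ordered_products_Cons_skip:
  "ordered_products G xs \<subseteq> ordered_products G (x # xs)"
proof
  fix p assume "p \<in> ordered_products G xs"
  then obtain I where I: "I \<subseteq> {..<length xs}" "I \<noteq> {}" "p = list_product G (nths xs I)"
    by (auto simp: ordered_products_def)
  have "nths (x # xs) (Suc ` I) = nths xs I"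
    by (simp add: nths_Cons inj_image_mem_iff)
  with I show "p \<in> ordered_products G (x # xs)"
    unfolding ordered_products_def by (auto intro!: exI[of _ "Suc ` I"])
qed

lemma ordered_products_Cons_take:
  assumes "q = \<one> \<or> q \<in> ordered_products G xs"
  shows "x \<otimes> q \<in> ordered_products G (x # xs)"
proof -
  have "\<exists>I. I \<subseteq> {..<length xs} \<and> q = list_product G (nths xs I)"
    using assms by (auto simp: ordered_products_def list_product_def intro: exI[of _ "{}"])
  then obtain I where I: "I \<subseteq> {..<length xs}" "q = list_product G (nths xs I)"
    by blast
  have "nths (x # xs) (insert 0 (Suc ` I)) = x # nths xs I"
    by (simp add: nths_Cons inj_image_mem_iff)
  with I show ?thesis
    unfolding ordered_products_def
    by (auto simp: list_product_def intro!: exI[of _ "insert 0 (Suc ` I)"])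
qed

definition delta_one :: "'a \<Rightarrow> bit" where
  "delta_one h = of_bool (h = \<one>)"

text \<open>The element \<open>(g\<^sub>1 + 1) \<cdots> (g\<^sub>l + 1)\<close> of the group algebra.\<close>

definition difference_product :: "'a list \<Rightarrow> 'a \<Rightarrow> bit" where
  "difference_product xs = foldr (\<lambda>f v. f v + v) (map translate xs) delta_one"

lemma difference_product_Nil: "difference_product [] = delta_one"
  by (simp add: difference_product_def)

lemma difference_product_Cons:
  "h \<in> carrier G \<Longrightarrow>
     difference_product (x # xs) h = difference_product xs (inv x \<otimes> h) + difference_product xs h"
  by (simp add: difference_product_def translate_def)

text \<open>
  Expanding \<open>(g\<^sub>1 + 1) \<cdots> (g\<^sub>l + 1)\<close> produces one summand for each subsequence, the empty one
  contributing the identity.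
\<close>

lemma difference_product_support:
  assumes "set xs \<subseteq> carrier G" "h \<in> carrier G" "difference_product xs h \<noteq> 0"
  shows "h = \<one> \<or> h \<in> ordered_products G xs"
  using assms
proof (induction xs arbitrary: h)
  case Nil
  then show ?case by (simp add: difference_product_Nil delta_one_def split: if_splits)
next
  case (Cons x xs)
  then have x: "x \<in> carrier G" by simp
  from Cons.prems consider "difference_product xs (inv x \<otimes> h) \<noteq> 0" | "difference_product xs h \<noteq> 0"
    by (auto simp: difference_product_Cons)
  then show ?case
  proof cases
    case 1
    with Cons x have "inv x \<otimes> h = \<one> \<or> inv x \<otimes> h \<in> ordered_products G xs"
      by auto
    then have "x \<otimes> (inv x \<otimes> h) \<in> ordered_products G (x # xs)"
      by (rule ordered_products_Cons_take)
    with x Cons.prems show ?thesis by (simp flip: m_assoc)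
  next
    case 2
    with Cons ordered_products_Cons_skip[of xs x] show ?thesis by auto
  qed
qed

text \<open>
  Only the empty subsequence contributes to the coefficient at the identity. In the
  inductive step the other possible contribution is the coefficient of the shorter product at
  \<open>inv x\<close>; were it nonzero, \<open>x\<close> followed by a subsequence with product \<open>inv x\<close> would give \<open>\<one>\<close>.
\<close>

lemma difference_product_at_one:
  assumes "set xs \<subseteq> carrier G" "\<one> \<notin> ordered_products G xs"
  shows "difference_product xs \<one> = 1"
  using assms
proof (induction xs)
  case Nil
  then show ?case by (simp add: difference_product_Nil delta_one_def)
next
  case (Cons x xs)
  then have x: "x \<in> carrier G" by simp
  have "difference_product xs (inv x) = 0"
  proof (rule ccontr)
    assume "difference_product xs (inv x) \<noteq> 0"
    with Cons.prems have "inv x = \<one> \<or> inv x \<in> ordered_products G xs"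
      by (intro difference_product_support) auto
    then have "x \<otimes> inv x \<in> ordered_products G (x # xs)"
      by (rule ordered_products_Cons_take)
    with x Cons.prems show False by simp
  qed
  moreover have "difference_product xs \<one> = 1"
    using Cons ordered_products_Cons_skip[of xs x] by auto
  ultimately show ?case using x by (simp add: difference_product_Cons)
qed

end


section \<open>Split metacyclic 2-groups\<close>

text \<open>
  The group \<open>\<langle>a\<rangle> \<rtimes> \<langle>b\<rangle>\<close> with \<open>o(a) = 2 ^ s\<close> and \<open>o(b) = 2 ^ t\<close>, described by equations that transfer
  along isomorphisms. The axiom \<open>trivial_iff\<close> encodes at once the two orders and the trivial
  intersection of \<open>\<langle>a\<rangle>\<close> and \<open>\<langle>b\<rangle>\<close>.
\<close>

locale split_metacyclic_2group = group G for G (structure) +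
  fixes a b and k s t :: nat
  assumes a_closed: "a \<in> carrier G" and b_closed: "b \<in> carrier G"
    and normal_form: "g \<in> carrier G \<Longrightarrow> \<exists>(i::nat) (j::nat). g = a [^] i \<otimes> b [^] j"
    and conjugation: "b \<otimes> a = a [^] (2 * k + 1) \<otimes> b"
    and trivial_iff: "a [^] (i::nat) \<otimes> b [^] (j::nat) = \<one> \<longleftrightarrow> 2 ^ s dvd i \<and> 2 ^ t dvd j"
begin

lemma a_period: "a [^] ((2::nat) ^ s) = \<one>"
  using trivial_iff[of "2 ^ s" 0] a_closed by simp

lemma b_period: "b [^] ((2::nat) ^ t) = \<one>"
  using trivial_iff[of 0 "2 ^ t"] b_closed by simp

sublocale twisted_operator_pair "translate a" "translate b" k s t
proof
  show "v + v = 0" for v :: "'a \<Rightarrow> bit"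
    by (auto simp: fun_eq_iff)
  show "translate b (translate a v) = (translate a ^^ (2 * k + 1)) (translate b v)" for v
    unfolding translate_pow[OF a_closed, symmetric]
    using a_closed b_closed by (simp only: conjugation nat_pow_closed flip: translate_mult)
qed (simp_all add: translate_add translate_one a_period b_period a_closed b_closed
      flip: translate_pow)

lemma difference_raises_translate: "g \<in> carrier G \<Longrightarrow> difference_raises 1 (translate g)"
proof -
  assume "g \<in> carrier G"
  then obtain i j :: nat where g: "g = a [^] i \<otimes> b [^] j"
    using normal_form by blast
  have "translate g = (translate a ^^ i) \<circ> (translate b ^^ j)"
    by (auto simp: g translate_mult a_closed b_closed simp flip: translate_pow)
  then show ?thesis
    by (simp only: difference_raises_comp difference_raises_funpow difference_raises_A difference_raises_B)
qed

lemma ordered_product_one_if_long: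
  assumes "set xs \<subseteq> carrier G" "length xs \<ge> 2 ^ s + 2 ^ t - 1"
  shows "\<one> \<in> ordered_products G xs"
proof (rule ccontr)
  assume "\<one> \<notin> ordered_products G xs"
  then have "difference_product xs \<one> = 1"
    using assms(1) by (intro difference_product_at_one)
  moreover have "difference_product xs = 0"
    unfolding difference_product_def using assms
    by (intro product_of_differences_vanishes) (auto simp: difference_raises_translate[unfolded One_nat_def])
  ultimately show False by simp
qed

lemma ordered_davenport_le: "ordered_davenport G \<le> 2 ^ s + 2 ^ t - 1"
  unfolding ordered_davenport_def using ordered_product_one_if_long by (intro Least_le) auto

lemma b_a_pow: "b \<otimes> a [^] n = a [^] ((2 * k + 1) * n) \<otimes> b"
proof (induction n)
  case 0
  then show ?case by (simp add: b_closed)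
next
  case (Suc n)
  have "b \<otimes> a [^] Suc n = (b \<otimes> a [^] n) \<otimes> a"
    by (simp add: a_closed b_closed m_assoc)
  also have "\<dots> = a [^] ((2 * k + 1) * n) \<otimes> (b \<otimes> a)"
    by (simp only: Suc a_closed b_closed m_assoc nat_pow_closed)
  also have "\<dots> = a [^] ((2 * k + 1) * n + (2 * k + 1)) \<otimes> b"
    by (simp only: conjugation a_closed b_closed m_assoc[symmetric] nat_pow_closed nat_pow_mult)
  finally show ?case by (simp only: mult_Suc_right add.commute)
qed

text \<open>
  Moving every \<open>b\<close> to the right changes only the exponent of \<open>a\<close>, so the exponent of \<open>b\<close> still counts
  the occurrences of \<open>b\<close>. These are counted as the entries different from \<open>a\<close>, which keeps the
  statement correct in the degenerate case \<open>a = b = \<one>\<close>.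
\<close>

lemma list_product_normal_form:
  assumes "set xs \<subseteq> {a, b}"
  shows "\<exists>n::nat. list_product G xs = a [^] n \<otimes> b [^] length (filter (\<lambda>x. x \<noteq> a) xs)"
  using assms
proof (induction xs)
  case Nil
  then show ?case by (auto simp: list_product_def intro!: exI[of _ 0])
next
  case (Cons x xs)
  then obtain n :: nat where
    n: "list_product G xs = a [^] n \<otimes> b [^] length (filter (\<lambda>x. x \<noteq> a) xs)"
    by auto
  let ?j = "length (filter (\<lambda>x. x \<noteq> a) xs)"
  have Cons_eq: "list_product G (x # xs) = x \<otimes> (a [^] n \<otimes> b [^] ?j)"
    using n by (simp add: list_product_def)
  show ?case
  proof (cases "x = a")
    case True
    have "a \<otimes> (a [^] n \<otimes> b [^] ?j) = a [^] Suc n \<otimes> b [^] ?j"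
      by (simp only: nat_pow_Suc2 m_assoc a_closed b_closed nat_pow_closed)
    with True Cons_eq show ?thesis by (auto intro!: exI[of _ "Suc n"])
  next
    case False
    with Cons.prems have "x = b" by auto
    have "b \<otimes> (a [^] n \<otimes> b [^] ?j) = a [^] ((2 * k + 1) * n) \<otimes> b [^] Suc ?j"
      by (simp only: nat_pow_Suc2 m_assoc[symmetric] a_closed b_closed nat_pow_closed b_a_pow)
    with False \<open>x = b\<close> Cons_eq show ?thesis
      by (auto intro!: exI[of _ "(2 * k + 1) * n"])
  qed
qed

definition extremal_sequence :: "'a multiset" where
  "extremal_sequence = replicate_mset (2 ^ s - 1) a + replicate_mset (2 ^ t - 1) b"

lemma list_product_replicate: "list_product G (replicate n a) = a [^] n"
  using nat_pow_Suc2[OF a_closed] by (induction n) (simp_all add: list_product_def)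

text \<open>
  In a subproduct equal to \<open>\<one>\<close> the number of \<open>b\<close>s is divisible by \<open>2 ^ t\<close> but less than \<open>2 ^ t\<close>,
  so no \<open>b\<close> occurs; the same argument then excludes \<open>a\<close>.
\<close>

lemma extremal_sequence_product_one_free:
  "\<one> \<notin> subseq_products G extremal_sequence"
proof
  assume "\<one> \<in> subseq_products G extremal_sequence"
  then obtain xs where xs: "mset xs \<subseteq># extremal_sequence" "xs \<noteq> []" "list_product G xs = \<one>"
    by (auto simp: subseq_products_def seq_products_def Suc_le_eq)
  have count: "count (mset xs) x \<le> count extremal_sequence x" for x
    using xs(1) by (simp add: subseteq_mset_def)
  have set: "set xs \<subseteq> {a, b}"
    using set_mset_mono[OF xs(1)] by (auto simp: extremal_sequence_def split: if_splits)
  let ?j = "length (filter (\<lambda>x. x \<noteq> a) xs)"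
  have "mset (filter (\<lambda>x. x \<noteq> a) xs) \<subseteq># filter_mset (\<lambda>x. x \<noteq> a) extremal_sequence"
    using xs(1) by (simp add: multiset_filter_mono)
  from size_mset_mono[OF this] have "?j \<le> size (filter_mset (\<lambda>x. x \<noteq> a) extremal_sequence)"
    by (simp only: size_mset)
  also have "\<dots> \<le> 2 ^ t - 1"
  proof -
    have "filter_mset P (replicate_mset n x) = (if P x then replicate_mset n x else {#})"
      for P :: "'a \<Rightarrow> bool" and n x
      by (induction n) auto
    then show ?thesis
      by (simp add: extremal_sequence_def)
  qed
  finally have "?j < 2 ^ t"
    by (metis One_nat_def Suc_pred le_imp_less_Suc pos2 zero_less_power)
  moreover obtain n :: nat where "list_product G xs = a [^] n \<otimes> b [^] ?j"
    using list_product_normal_form[OF set] by blast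
  with xs(3) have "2 ^ t dvd ?j"
    using trivial_iff by metis
  ultimately have "?j = 0"
    by (metis dvd_imp_le linorder_not_less neq0_conv)
  then have all_a: "\<forall>x \<in> set xs. x = a"
    by (simp add: filter_empty_conv)
  have "xs = replicate (length xs) a"
    using all_a by (simp add: replicate_length_same)
  with xs(3) have "a [^] length xs = \<one>"
    by (metis list_product_replicate)
  then have "2 ^ s dvd length xs"
    using trivial_iff[of "length xs" 0] a_closed by simp
  moreover have "length xs < 2 ^ s"
  proof (cases "a = b")
    case True
    \<comment> \<open>Then the group is trivial and the extremal sequence is empty.\<close>
    have "a [^] (1::nat) \<otimes> b [^] ((2::nat) ^ t - 1) = b [^] (1 + ((2::nat) ^ t - 1))"
      unfolding True using b_closed by (rule nat_pow_mult)
    also have "\<dots> = \<one>"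
      by (simp add: b_period)
    finally have "2 ^ s dvd (1::nat)" "2 ^ t dvd (2::nat) ^ t - 1"
      using trivial_iff by blast+
    then have "s = 0"
      by simp
    have "(2::nat) ^ t - 1 = 0"
    proof (rule ccontr)
      assume "(2::nat) ^ t - 1 \<noteq> 0"
      with \<open>2 ^ t dvd (2::nat) ^ t - 1\<close> have "(2::nat) ^ t \<le> 2 ^ t - 1"
        using dvd_imp_le by blast
      moreover have "(0::nat) < 2 ^ t" by simp
      ultimately show False by linarith
    qed
    moreover have "length xs \<le> (2 ^ s - 1) + (2 ^ t - 1)"
      using size_mset_mono[OF xs(1)] by (simp add: extremal_sequence_def)
    ultimately show ?thesis
      using \<open>s = 0\<close> by simp
  next
    case False
    have "length xs = count (mset xs) a"
      using all_a by (metis count_replicate_mset mset_replicate replicate_length_same)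
    with count[of a] False have "length xs \<le> 2 ^ s - 1"
      by (simp add: extremal_sequence_def)
    then show ?thesis
      by (metis One_nat_def Suc_pred le_imp_less_Suc pos2 zero_less_power)
  qed
  ultimately have "length xs = 0"
    by (metis dvd_imp_le linorder_not_less neq0_conv)
  with xs(2) show False by simp
qed

lemma small_davenport_ge:
  assumes "finite (carrier G)"
  shows "2 ^ s + 2 ^ t - 2 \<le> small_davenport G"
proof -
  have "size extremal_sequence = 2 ^ s + 2 ^ t - 2"
    by (simp add: extremal_sequence_def)
  moreover have "set_mset extremal_sequence \<subseteq> carrier G"
    by (auto simp: extremal_sequence_def a_closed b_closed split: if_splits)
  ultimately show ?thesis
    unfolding small_davenport_def
    using bdd_above_small_davenport_set[OF assms] extremal_sequence_product_one_free
    by (intro cSup_upper) (auto intro!: exI[of _ extremal_sequence])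
qed

end

text \<open>
  The supremum is attained by some product-one free multiset; any ordering of it is an ordered
  sequence witnessing that \<open>ordered_davenport G\<close> exceeds its length.
\<close>

lemma (in group) small_davenport_less_ordered_davenport:
  assumes fin: "finite (carrier G)"
  shows "small_davenport G < ordered_davenport G"
proof -
  let ?D = "{size S | S. set_mset S \<subseteq> carrier G \<and> \<one> \<notin> subseq_products G S}"
  have "finite ?D" "?D \<noteq> {}"
    using zero_in_small_davenport_set[of G] bdd_above_small_davenport_set[OF fin]
    unfolding bdd_above_nat by blast+
  then have "Sup ?D \<in> ?D"
    unfolding Sup_nat_def by (subst if_not_P) (assumption, rule Max_in)
  then obtain S where S: "small_davenport G = size S" "set_mset S \<subseteq> carrier G"
      "\<one> \<notin> subseq_products G S"
    unfolding small_davenport_def by blast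
  obtain xs where xs: "mset xs = S"
    by (metis ex_mset)
  with S ordered_products_subset[of G xs] have "\<one> \<notin> ordered_products G xs"
    by auto
  moreover have "\<forall>xs. set xs \<subseteq> carrier G \<and> length xs \<ge> ordered_davenport G
      \<longrightarrow> \<one> \<in> ordered_products G xs"
    unfolding ordered_davenport_def by (rule LeastI_ex[OF ex_ordered_davenport_bound[OF fin]])
  ultimately show ?thesis
    using S xs by (metis linorder_not_less set_mset_mset size_mset)
qed

lemma (in split_metacyclic_2group) ordered_davenport_eq_small_davenport:
  assumes "finite (carrier G)"
  shows "ordered_davenport G = small_davenport G + 1"
proof -
  have "(1::nat) \<le> 2 ^ s" "(1::nat) \<le> 2 ^ t"
    by simp_all
  then show ?thesis
    using ordered_davenport_le small_davenport_ge[OF assms]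
      small_davenport_less_ordered_davenport[OF assms] by linarith
qed

section \<open>From the presentation to the normal form\<close>

lemma (in group) conjugate_pow:
  assumes "x \<in> carrier G" "y \<in> carrier G"
  shows "(x \<otimes> y \<otimes> inv x) [^] (n::nat) = x \<otimes> y [^] n \<otimes> inv x"
proof (induction n)
  case (Suc n)
  have "(x \<otimes> y [^] n \<otimes> inv x) \<otimes> (x \<otimes> y \<otimes> inv x) = x \<otimes> y [^] n \<otimes> (inv x \<otimes> x) \<otimes> y \<otimes> inv x"
    using assms by (simp only: m_assoc m_closed nat_pow_closed inv_closed)
  with Suc assms show ?case by (simp add: m_assoc)
qed (use assms in simp)

text \<open>
  Normality of \<open>\<langle>a\<rangle>\<close> yields \<open>b a b\<^sup>-\<^sup>1 = a ^ r\<close>. For even \<open>r\<close> the \<open>2 ^ (\<alpha> - 1)\<close>-th power of the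
  right-hand side would be trivial, whereas the left-hand side has the same order \<open>2 ^ \<alpha>\<close> as \<open>a\<close>.
\<close>

lemma split_metacyclic_2group_of_is_G2:
  assumes "is_G2 H a b \<alpha> \<beta> \<gamma>" "\<alpha> > 0"
  obtains k where "split_metacyclic_2group H a b k \<alpha> \<beta>"
proof -
  from assms interpret H: group H
    by (simp add: is_G2_def)
  let ?N = "generate H {a}" and ?K = "generate H {b}"
  from assms have ab: "a \<in> carrier H" "b \<in> carrier H"
    and ord: "H.ord a = 2 ^ \<alpha>" "H.ord b = 2 ^ \<beta>"
    and normal: "?N \<lhd> H" and int: "?N \<inter> ?K = {\<one>\<^bsub>H\<^esub>}" and prod: "?N <#>\<^bsub>H\<^esub> ?K = carrier H"
    by (auto simp: is_G2_def internal_semidirect_def)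
  note [simp] = ab
  have N: "?N = {a [^]\<^bsub>H\<^esub> n | n. n \<in> (UNIV :: nat set)}"
    by (intro H.generate_pow_nat) (auto simp: ord)
  have K: "?K = {b [^]\<^bsub>H\<^esub> n | n. n \<in> (UNIV :: nat set)}"
    by (intro H.generate_pow_nat) (auto simp: ord)
  have "a \<in> ?N"
    by (simp add: generate.incl)
  then have "b \<otimes>\<^bsub>H\<^esub> a \<otimes>\<^bsub>H\<^esub> inv\<^bsub>H\<^esub> b \<in> ?N"
    using normal.inv_op_closed2[OF normal] by simp
  then obtain r :: nat where r: "b \<otimes>\<^bsub>H\<^esub> a \<otimes>\<^bsub>H\<^esub> inv\<^bsub>H\<^esub> b = a [^]\<^bsub>H\<^esub> r"
    using N by auto
  have "odd r"
  proof
    assume "even r"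
    then have "2 ^ \<alpha> dvd r * 2 ^ (\<alpha> - 1)"
      using assms(2) by (metis dvd_refl mult_dvd_mono power_eq_if neq0_conv)
    then have "a [^]\<^bsub>H\<^esub> (r * 2 ^ (\<alpha> - 1)) = \<one>\<^bsub>H\<^esub>"
      by (simp add: H.pow_eq_id ord)
    then have "b \<otimes>\<^bsub>H\<^esub> a [^]\<^bsub>H\<^esub> ((2::nat) ^ (\<alpha> - 1)) \<otimes>\<^bsub>H\<^esub> inv\<^bsub>H\<^esub> b = \<one>\<^bsub>H\<^esub>"
      by (simp add: r H.nat_pow_pow flip: H.conjugate_pow)
    then have "a [^]\<^bsub>H\<^esub> ((2::nat) ^ (\<alpha> - 1)) = \<one>\<^bsub>H\<^esub>"
      by (metis H.inv_equality H.inv_inv H.l_cancel_one H.inv_closed H.m_closed H.nat_pow_closed ab)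
    then have "(2::nat) ^ \<alpha> dvd 2 ^ (\<alpha> - 1)"
      by (simp add: H.pow_eq_id ord)
    with assms(2) show False
      by (auto dest: dvd_imp_le)
  qed
  then obtain k where k: "r = 2 * k + 1"
    by (elim oddE)
  have "split_metacyclic_2group H a b k \<alpha> \<beta>"
  proof
    show "b \<otimes>\<^bsub>H\<^esub> a = a [^]\<^bsub>H\<^esub> (2 * k + 1) \<otimes>\<^bsub>H\<^esub> b"
      unfolding r[unfolded k, symmetric] by (simp add: H.m_assoc)
    show "\<exists>(i::nat) (j::nat). g = a [^]\<^bsub>H\<^esub> i \<otimes>\<^bsub>H\<^esub> b [^]\<^bsub>H\<^esub> j" if "g \<in> carrier H" for g
      using that unfolding prod[symmetric] set_mult_def N K by auto
    show "a [^]\<^bsub>H\<^esub> i \<otimes>\<^bsub>H\<^esub> b [^]\<^bsub>H\<^esub> j = \<one>\<^bsub>H\<^esub> \<longleftrightarrow> 2 ^ \<alpha> dvd i \<and> 2 ^ \<beta> dvd j" for i j :: nat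
    proof
      assume eq: "a [^]\<^bsub>H\<^esub> i \<otimes>\<^bsub>H\<^esub> b [^]\<^bsub>H\<^esub> j = \<one>\<^bsub>H\<^esub>"
      then have "a [^]\<^bsub>H\<^esub> i = inv\<^bsub>H\<^esub> (b [^]\<^bsub>H\<^esub> j)"
        by (simp add: H.inv_equality)
      moreover have "b [^]\<^bsub>H\<^esub> j \<in> ?K"
        using K by auto
      then have "inv\<^bsub>H\<^esub> (b [^]\<^bsub>H\<^esub> j) \<in> ?K"
        by (simp add: H.generate_m_inv_closed)
      moreover have "a [^]\<^bsub>H\<^esub> i \<in> ?N"
        using N by auto
      ultimately have "a [^]\<^bsub>H\<^esub> i \<in> ?N \<inter> ?K"
        by (simp only: Int_iff simp_thms)
      then have "a [^]\<^bsub>H\<^esub> i = \<one>\<^bsub>H\<^esub>"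
        by (simp only: int singleton_iff)
      with eq show "2 ^ \<alpha> dvd i \<and> 2 ^ \<beta> dvd j"
        by (simp add: H.pow_eq_id ord)
    next
      assume "2 ^ \<alpha> dvd i \<and> 2 ^ \<beta> dvd j"
      then have "a [^]\<^bsub>H\<^esub> i = \<one>\<^bsub>H\<^esub>" "b [^]\<^bsub>H\<^esub> j = \<one>\<^bsub>H\<^esub>"
        by (simp_all add: H.pow_eq_id ord)
      then show "a [^]\<^bsub>H\<^esub> i \<otimes>\<^bsub>H\<^esub> b [^]\<^bsub>H\<^esub> j = \<one>\<^bsub>H\<^esub>"
        by simp
    qed
  qed auto
  then show thesis by (rule that)
qed

lemma split_metacyclic_2group_iso:
  assumes "split_metacyclic_2group H a b k s t" "group G" "\<phi> \<in> iso H G"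
  shows "split_metacyclic_2group G (\<phi> a) (\<phi> b) k s t"
proof -
  interpret H: split_metacyclic_2group H a b k s t by fact
  interpret G: group G by fact
  interpret \<phi>: group_hom H G \<phi>
    using assms(3) by unfold_locales (auto simp: iso_def)
  note [simp] = H.a_closed H.b_closed
  have bij: "bij_betw \<phi> (carrier H) (carrier G)"
    using assms(3) by (simp add: iso_def)
  have monomial: "\<phi> a [^]\<^bsub>G\<^esub> i \<otimes>\<^bsub>G\<^esub> \<phi> b [^]\<^bsub>G\<^esub> j = \<phi> (a [^]\<^bsub>H\<^esub> i \<otimes>\<^bsub>H\<^esub> b [^]\<^bsub>H\<^esub> j)"
    for i j :: nat
    by (simp add: \<phi>.hom_nat_pow)
  show ?thesis
  proof
    show "\<exists>(i::nat) (j::nat). g = \<phi> a [^]\<^bsub>G\<^esub> i \<otimes>\<^bsub>G\<^esub> \<phi> b [^]\<^bsub>G\<^esub> j" if "g \<in> carrier G" for g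
      using that bij H.normal_form unfolding monomial bij_betw_def by blast
    show "\<phi> b \<otimes>\<^bsub>G\<^esub> \<phi> a = \<phi> a [^]\<^bsub>G\<^esub> (2 * k + 1) \<otimes>\<^bsub>G\<^esub> \<phi> b"
      using arg_cong[OF H.conjugation, of \<phi>] by (simp add: \<phi>.hom_nat_pow del: nat_pow_Suc)
    show "\<phi> a [^]\<^bsub>G\<^esub> i \<otimes>\<^bsub>G\<^esub> \<phi> b [^]\<^bsub>G\<^esub> j = \<one>\<^bsub>G\<^esub> \<longleftrightarrow> 2 ^ s dvd i \<and> 2 ^ t dvd j" for i j :: nat
      unfolding monomial H.trivial_iff[symmetric]
      using bij unfolding bij_betw_def \<phi>.inj_on_one_iff
      by (metis H.m_closed H.nat_pow_closed H.a_closed H.b_closed \<phi>.hom_one)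
  qed auto
qed

theorem corollary1p6:
  fixes G :: "('a, 'm) monoid_scheme" and G2 :: "('b, 'n) monoid_scheme"
    and a b :: 'b and \<alpha> \<beta> \<gamma> :: nat
  assumes "\<alpha> > 0" and "\<beta> > 0" and "\<gamma> > 0"
    and "\<alpha> \<ge> 2 * \<gamma>" and "\<beta> \<ge> \<gamma>" and "\<gamma> \<ge> 1" and "\<alpha> + \<beta> > 3"
    and "is_G2 G2 a b \<alpha> \<beta> \<gamma>"
    and "group G" and "finite (carrier G)" and "G \<cong> G2"
  shows "ordered_davenport G = small_davenport G + 1"
proof -
  obtain k where "split_metacyclic_2group G2 a b k \<alpha> \<beta>"
    by (rule split_metacyclic_2group_of_is_G2[OF assms(8,1)])
  moreover obtain \<phi> where "\<phi> \<in> iso G2 G"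
    using group.iso_sym[OF assms(9,11)] by (auto simp: is_iso_def)
  ultimately have "split_metacyclic_2group G (\<phi> a) (\<phi> b) k \<alpha> \<beta>"
    by (rule split_metacyclic_2group_iso[OF _ assms(9)])
  then show ?thesis
    using assms(10) by (rule split_metacyclic_2group.ordered_davenport_eq_small_davenport)
qed

end
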